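(* Let $R\in\mathbb N^{n+1}$ and let $\Lambda$ be a sub-lattice of $\Lambda_R$ of rank $n$. Then $\Lambda$ has a Riemann-Roch formula if and only if $\Lambda$ is uniform and reflection invariant; in particular, in this case $\Lambda$ has the Riemann-Roch property.
   Context: $\mathbb N$ denotes the positive integers; inequalities between vectors are coordinatewise; $\vec 0$ is the zero vector. For $R=(r_0,\dots,r_n)\in\mathbb N^{n+1}$ put $H_R=\{x\in\mathbb R^{n+1}: x\cdot R=0\}$, $\Lambda_R=H_R\cap\mathbb Z^{n+1}$, and $\deg_R(x)=x\cdot R$. Elements of $\mathbb Z^{n+1}$ are called divisors. Let $\Lambda\subseteq\Lambda_R$ be a sub-lattice of rank $n$. Rank: $D\sim D'$ means $D-D'\in\Lambda$; a divisor $E$ is effective if $E\ge\vec 0$; $|D|=\{E\in\mathbb Z^{n+1}:E\ge\vec 0,\ E\sim D\}$; and $r(D)=\min\{\deg_R(E): E\in\mathbb Z^{n+1},\ E\ge\vec 0,\ |D-E|=\emptyset\}-1$. Extreme divisors: $\Sigma(\Lambda)=\{D\in\mathbb Z^{n+1}: D\not\ge p \text{ for all } p\in\Lambda\}$. $Ext(\Sigma(\Lambda))$ is the set of $\nu\in\Sigma(\Lambda)$ such that $\deg_R(\nu)\ge\deg_R(p)$ for all $p\in N(\nu)\cap\Sigma(\Lambda)$, where $N(\nu)=\{D\in\mathbb Z^{n+1}:\sum_i|D_i-\nu_i|\le 1\}$. Define $g_{\min}=\min\{\deg_R(\nu):\nu\in Ext(\Sigma(\Lambda))\}+1$ and $g_{\max}=\max\{\deg_R(\nu):\nu\in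 Ext(\Sigma(\Lambda))\}+1$. $\Lambda$ is uniform if $g_{\min}=g_{\max}$. Critical points: $\Delta_R=\{x\in H_R:x\le R\}$, and for $p\in H_R$, $d_{\Delta_R}(p,\Lambda)=\min\{\lambda\ge 0:\exists q\in\Lambda,\ q\in p+\lambda\Delta_R\}$. $Crit(\Lambda)$ is the set of $\nu\in H_R$ for which there is $\delta>0$ with $d_{\Delta_R}(\nu,\Lambda)\ge d_{\Delta_R}(p,\Lambda)$ for all $p\in H_R$ with $\|p-\nu\|\le\delta$ (Euclidean norm). $\Lambda$ is reflection invariant if there is $v\in\mathbb R^{n+1}$ with $-Crit(\Lambda)=Crit(\Lambda)+v$. Riemann-Roch formula: $\Lambda$ has the Riemann-Roch formula if there exist $m\in\mathbb Z$ and a divisor $K$ with $\deg_R(K)=2m-2$ such that $r(D)-r(K-D)=\deg_R(D)-m+1$ for all $D\in\mathbb Z^{n+1}$. Riemann-Roch property: $\Lambda$ has the Riemann-Roch property if it is uniform and, with $g=g_{\min}=g_{\max}$, there is a divisor $K$ with $\deg_R(K)=2g-2$ such that $r(D)-r(K-D)=\deg_R(D)-g+1$ for all $D\in\mathbb Z^{n+1}$. *)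

theory Defs
  imports "HOL-Analysis.Analysis"
begin

text \<open>
  Coordinates are indexed by a finite type \<open>'n\<close> with \<open>n + 1\<close> elements, so divisors are the
  elements of \<open>int ^ 'n\<close>. The order \<open>\<le>\<close> on vectors is the coordinatewise one of the library.
  Minima and maxima are written with \<open>LEAST\<close> and \<open>GREATEST\<close>, which denote an attained
  minimum or maximum (and are unspecified if there is none). For \<open>R > 0\<close> and \<open>L\<close> of full
  rank in \<open>Lambda_R R\<close>, all those below are attained.
\<close>

text \<open>The polymorphic element type makes this both the degree of a divisor and the functional
  \<open>x \<bullet> R\<close> on real vectors.\<close>

definition deg :: "nat ^ 'n \<Rightarrow> 'a::comm_semiring_1 ^ 'n \<Rightarrow> 'a" where
  "deg R x = (\<Sum>i\<in>UNIV. x $ i * of_nat (R $ i))"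

definition real_vec :: "int ^ 'n \<Rightarrow> real ^ 'n" where
  "real_vec D = (\<chi> i. real_of_int (D $ i))"

definition hyperplane_R :: "nat ^ 'n \<Rightarrow> (real ^ 'n) set" where
  "hyperplane_R R = {x. deg R x = 0}"

definition Lambda_R :: "nat ^ 'n \<Rightarrow> (int ^ 'n) set" where
  "Lambda_R R = {D. real_vec D \<in> hyperplane_R R}"

definition sublattice :: "(int ^ 'n) set \<Rightarrow> (int ^ 'n) set \<Rightarrow> bool" where
  "sublattice L M \<longleftrightarrow> L \<subseteq> M \<and> 0 \<in> L \<and> (\<forall>p\<in>L. \<forall>q\<in>L. p - q \<in> L)"

text \<open>The rank of a (discrete) lattice is the dimension of its real span.\<close>

definition lattice_rank :: "(int ^ 'n) set \<Rightarrow> nat" where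
  "lattice_rank L = dim (span (real_vec ` L))"


subsection \<open>Rank of a divisor\<close>

definition lin_equiv :: "(int ^ 'n) set \<Rightarrow> int ^ 'n \<Rightarrow> int ^ 'n \<Rightarrow> bool" where
  "lin_equiv L D D' \<longleftrightarrow> D - D' \<in> L"

definition effective :: "int ^ 'n \<Rightarrow> bool" where
  "effective E \<longleftrightarrow> 0 \<le> E"

definition linear_system :: "(int ^ 'n) set \<Rightarrow> int ^ 'n \<Rightarrow> (int ^ 'n) set" where
  "linear_system L D = {E. effective E \<and> lin_equiv L E D}"

definition div_rank :: "nat ^ 'n \<Rightarrow> (int ^ 'n) set \<Rightarrow> int ^ 'n \<Rightarrow> int" where
  "div_rank R L D =
     (LEAST d. \<exists>E. effective E \<and> linear_system L (D - E) = {} \<and> d = deg R E) - 1"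


subsection \<open>Extreme divisors\<close>

definition Sigma_region :: "(int ^ 'n) set \<Rightarrow> (int ^ 'n) set" where
  "Sigma_region L = {D. \<forall>p\<in>L. \<not> p \<le> D}"

definition neighbours :: "int ^ 'n \<Rightarrow> (int ^ 'n) set" where
  "neighbours \<nu> = {D. (\<Sum>i\<in>UNIV. \<bar>D $ i - \<nu> $ i\<bar>) \<le> 1}"

definition extreme_divisors :: "nat ^ 'n \<Rightarrow> (int ^ 'n) set \<Rightarrow> (int ^ 'n) set" where
  "extreme_divisors R L =
     {\<nu> \<in> Sigma_region L. \<forall>p \<in> neighbours \<nu> \<inter> Sigma_region L. deg R p \<le> deg R \<nu>}"

definition g_min :: "nat ^ 'n \<Rightarrow> (int ^ 'n) set \<Rightarrow> int" where
  "g_min R L = (LEAST d. d \<in> deg R ` extreme_divisors R L) + 1"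

definition g_max :: "nat ^ 'n \<Rightarrow> (int ^ 'n) set \<Rightarrow> int" where
  "g_max R L = (GREATEST d. d \<in> deg R ` extreme_divisors R L) + 1"

definition uniform_lattice :: "nat ^ 'n \<Rightarrow> (int ^ 'n) set \<Rightarrow> bool" where
  "uniform_lattice R L \<longleftrightarrow> g_min R L = g_max R L"


subsection \<open>Critical points\<close>

definition Delta_R :: "nat ^ 'n \<Rightarrow> (real ^ 'n) set" where
  "Delta_R R = {x \<in> hyperplane_R R. x \<le> (\<chi> i. real (R $ i))}"

definition dist_Delta :: "nat ^ 'n \<Rightarrow> (int ^ 'n) set \<Rightarrow> real ^ 'n \<Rightarrow> real" where
  "dist_Delta R L p =
     (LEAST t. 0 \<le> t \<and> (\<exists>q\<in>L. \<exists>x\<in>Delta_R R. real_vec q = p + t *\<^sub>R x))"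

definition crit :: "nat ^ 'n \<Rightarrow> (int ^ 'n) set \<Rightarrow> (real ^ 'n) set" where
  "crit R L = {\<nu> \<in> hyperplane_R R. \<exists>\<delta>>0. \<forall>p \<in> hyperplane_R R.
     norm (p - \<nu>) \<le> \<delta> \<longrightarrow> dist_Delta R L p \<le> dist_Delta R L \<nu>}"

definition reflection_invariant :: "nat ^ 'n \<Rightarrow> (int ^ 'n) set \<Rightarrow> bool" where
  "reflection_invariant R L \<longleftrightarrow> (\<exists>v. uminus ` crit R L = (\<lambda>x. x + v) ` crit R L)"


subsection \<open>Riemann-Roch\<close>

definition riemann_roch_formula :: "nat ^ 'n \<Rightarrow> (int ^ 'n) set \<Rightarrow> bool" where
  "riemann_roch_formula R L \<longleftrightarrow>
     (\<exists>m K. deg R K = 2 * m - 2 \<and>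
        (\<forall>D. div_rank R L D - div_rank R L (K - D) = deg R D - m + 1))"

definition riemann_roch_property :: "nat ^ 'n \<Rightarrow> (int ^ 'n) set \<Rightarrow> bool" where
  "riemann_roch_property R L \<longleftrightarrow>
     uniform_lattice R L \<and>
     (\<exists>K. deg R K = 2 * g_min R L - 2 \<and>
        (\<forall>D. div_rank R L D - div_rank R L (K - D) = deg R D - g_min R L + 1))"

end

theory Submission
  imports Defs
begin

text \<open>
  A divisor has empty linear system iff it lies in \<open>\<Sigma>(\<Lambda>)\<close>, and \<open>\<Sigma>(\<Lambda>)\<close> consists of the divisors
  lying below some extreme divisor, because its degrees are bounded above. Hence \<open>r(D) + 1\<close> is the
  minimum of \<open>deg (D - \<nu>)\<^sup>+\<close> over the extreme divisors \<open>\<nu>\<close>. Since \<open>x = x\<^sup>+ - (-x)\<^sup>+\<close>, the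
  Riemann-Roch formula holds with \<open>K\<close> and \<open>m\<close> as soon as all \<open>\<nu>\<close> have degree \<open>m - 1\<close> and
  \<open>\<nu> \<mapsto> K - \<nu>\<close> permutes them; evaluating the formula near an extreme divisor gives the converse.
  On the other side, the critical points are exactly the projections along \<open>R\<close> of the points
  \<open>\<nu> + (1, \<dots>, 1)\<close>. If all \<open>\<nu>\<close> have the same degree, this projection is a translation, so that the
  symmetry \<open>\<nu> \<mapsto> K - \<nu>\<close> becomes reflection invariance.
\<close>

section \<open>Degrees and positive parts\<close>

lemma deg_add: "deg R (x + y) = deg R x + deg R y"
  by (simp add: deg_def distrib_right sum.distrib)

lemma deg_diff: "deg R (x - y) = deg R x - deg R (y :: 'a::comm_ring_1 ^ 'n)"
  by (simp add: deg_def left_diff_distrib sum_subtractf)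

lemma deg_scaleR: "deg R (c *\<^sub>R x) = c * deg R (x :: real ^ 'n)"
  by (simp add: deg_def sum_distrib_left mult.assoc)

lemma deg_zero [simp]: "deg R 0 = 0"
  by (simp add: deg_def)

lemma deg_axis: "deg R (axis i c) = c * of_nat (R $ i)"
proof -
  have "deg R (axis i c) = (\<Sum>j\<in>UNIV. if j = i then c * of_nat (R $ j) else 0)"
    unfolding deg_def by (rule sum.cong) (auto simp: axis_def)
  then show ?thesis by simp
qed

lemma deg_mono:
  fixes x y :: "'a::linordered_idom ^ 'n"
  assumes "x \<le> y"
  shows "deg R x \<le> deg R y"
  unfolding deg_def using assms
  by (intro sum_mono mult_right_mono) (auto simp: less_eq_vec_def)

lemma deg_nonneg: "0 \<le> x \<Longrightarrow> 0 \<le> deg R (x :: 'a::linordered_idom ^ 'n)"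
  using deg_mono[of 0 x R] by simp

lemma deg_pos_component:
  fixes x :: "'a::linordered_idom ^ 'n"
  assumes "0 \<le> x" "0 < x $ i" "0 < R $ i"
  shows "0 < deg R x"
  unfolding deg_def
  by (rule sum_pos2[of _ i]) (use assms in \<open>auto simp: less_eq_vec_def\<close>)

lemma deg_real_vec: "deg R (real_vec D) = of_int (deg R D)"
  by (simp add: deg_def real_vec_def)

lemma real_vec_diff: "real_vec (x - y) = real_vec x - real_vec y"
  by (simp add: real_vec_def vec_eq_iff)

lemma real_vec_nth [simp]: "real_vec x $ i = of_int (x $ i)"
  by (simp add: real_vec_def)

lemma mem_Lambda_R: "D \<in> Lambda_R R \<longleftrightarrow> deg R D = 0"
  by (simp add: Lambda_R_def hyperplane_R_def deg_real_vec)

definition pos_part :: "int ^ 'n \<Rightarrow> int ^ 'n" where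
  "pos_part x = (\<chi> i. max 0 (x $ i))"

lemma pos_part_nonneg: "0 \<le> pos_part x"
  by (simp add: pos_part_def less_eq_vec_def)

lemma le_pos_part: "x \<le> pos_part x"
  by (simp add: pos_part_def less_eq_vec_def)

lemma pos_part_least: "0 \<le> y \<Longrightarrow> x \<le> y \<Longrightarrow> pos_part x \<le> y"
  by (simp add: pos_part_def less_eq_vec_def)

text \<open>Taking degrees, this identity is the source of the term \<open>deg R D\<close> in the
  Riemann-Roch formula.\<close>

lemma pos_part_uminus: "pos_part (- x) = pos_part x - x"
  by (auto simp: pos_part_def vec_eq_iff max_def)

text \<open>This vector serves both as the normal of the hyperplane and as the direction in which
  orthants are translated.\<close>

definition real_weights :: "nat ^ 'n \<Rightarrow> real ^ 'n" where
  "real_weights R = (\<chi> i. real (R $ i))"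

lemma real_weights_nth [simp]: "real_weights R $ i = real (R $ i)"
  by (simp add: real_weights_def)

lemma hyperplane_R_eq_inner: "hyperplane_R R = {x. real_weights R \<bullet> x = 0}"
  by (simp add: hyperplane_R_def deg_def inner_vec_def mult.commute)

lemma finite_bounded_int_vec: "finite {x :: int ^ 'n. \<forall>i. x $ i \<in> {-B..B}}"
proof (rule finite_subset)
  show "{x :: int ^ 'n. \<forall>i. x $ i \<in> {-B..B}} \<subseteq> vec_lambda ` (UNIV \<rightarrow>\<^sub>E {-B..B})"
  proof
    fix x :: "int ^ 'n"
    assume "x \<in> {x. \<forall>i. x $ i \<in> {-B..B}}"
    then have "vec_nth x \<in> UNIV \<rightarrow>\<^sub>E {-B..B}" by auto
    then show "x \<in> vec_lambda ` (UNIV \<rightarrow>\<^sub>E {-B..B})"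
      by (metis imageI vec_nth_inverse)
  qed
qed (intro finite_imageI finite_PiE, auto)

text \<open>The integers are not well-ordered, so the library rules for \<open>LEAST\<close> and \<open>GREATEST\<close> do not
  apply; the bound reduces to the natural numbers.\<close>

lemma Least_int_bounded_below:
  fixes S :: "int set"
  assumes "x \<in> S" "\<And>x. x \<in> S \<Longrightarrow> b \<le> x"
  shows "(LEAST x. x \<in> S) \<in> S" and "\<And>y. y \<in> S \<Longrightarrow> (LEAST x. x \<in> S) \<le> y"
proof -
  obtain m where m: "m \<in> S" "\<And>y. y \<in> S \<Longrightarrow> nat (m - b) \<le> nat (y - b)"
    using ex_has_least_nat[of "\<lambda>x. x \<in> S" x "\<lambda>x. nat (x - b)"] assms by auto
  have least: "m \<le> y" if "y \<in> S" for y
    using m(2)[OF that] assms(2)[OF that] assms(2)[OF m(1)] by linarith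
  have "(LEAST x. x \<in> S) = m"
    by (rule Least_equality) (use m least in auto)
  then show "(LEAST x. x \<in> S) \<in> S" and "\<And>y. y \<in> S \<Longrightarrow> (LEAST x. x \<in> S) \<le> y"
    using m least by auto
qed

lemma Greatest_int_bounded_above:
  fixes S :: "int set"
  assumes "x \<in> S" "\<And>x. x \<in> S \<Longrightarrow> x \<le> b"
  shows "(GREATEST x. x \<in> S) \<in> S" and "\<And>y. y \<in> S \<Longrightarrow> y \<le> (GREATEST x. x \<in> S)"
proof -
  obtain m where m: "m \<in> S" "\<And>y. y \<in> S \<Longrightarrow> nat (b - m) \<le> nat (b - y)"
    using ex_has_least_nat[of "\<lambda>x. x \<in> S" x "\<lambda>x. nat (b - x)"] assms by auto
  have greatest: "y \<le> m" if "y \<in> S" for y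
    using m(2)[OF that] assms(2)[OF that] assms(2)[OF m(1)] by linarith
  have "(GREATEST x. x \<in> S) = m"
    by (rule Greatest_equality) (use m greatest in auto)
  then show "(GREATEST x. x \<in> S) \<in> S" and "\<And>y. y \<in> S \<Longrightarrow> y \<le> (GREATEST x. x \<in> S)"
    using m greatest by auto
qed


section \<open>Extreme divisors and rank\<close>

lemma Sigma_region_downward: "D \<in> Sigma_region L \<Longrightarrow> D' \<le> D \<Longrightarrow> D' \<in> Sigma_region L"
  unfolding Sigma_region_def using order.trans by blast

text \<open>The substitution \<open>E = D - p\<close> exchanges effective divisors equivalent to
  \<open>D\<close> with lattice points below \<open>D\<close>; the sign change is absorbed by
  closure under negation.\<close>

lemma linear_system_empty_iff:
  assumes "\<And>p. p \<in> L \<Longrightarrow> - p \<in> L"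
  shows "linear_system L D = {} \<longleftrightarrow> D \<in> Sigma_region L"
proof
  assume empty: "linear_system L D = {}"
  show "D \<in> Sigma_region L"
    unfolding Sigma_region_def
  proof safe
    fix p assume "p \<in> L" "p \<le> D"
    then have "D - p \<in> linear_system L D"
      using assms[of p] by (simp add: linear_system_def effective_def lin_equiv_def less_eq_vec_def)
    then show False using empty by simp
  qed
next
  assume S: "D \<in> Sigma_region L"
  show "linear_system L D = {}"
  proof (rule ccontr)
    assume "linear_system L D \<noteq> {}"
    then obtain E where E: "0 \<le> E" "E - D \<in> L"
      by (auto simp: linear_system_def effective_def lin_equiv_def)
    from assms[OF E(2)] have "D - E \<in> L" by simp
    moreover have "D - E \<le> D" using E(1) by (simp add: less_eq_vec_def)
    ultimately show False using S by (auto simp: Sigma_region_def)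
  qed
qed

section \<open>Full-rank lattices: closure, strict monotonicity of the degree, approximation\<close>

locale full_rank_lattice =
  fixes R :: "nat ^ 'n" and L :: "(int ^ 'n) set"
  assumes weights_pos: "0 < R $ i"
    and sublattice: "sublattice L (Lambda_R R)"
    and full_rank: "lattice_rank L + 1 = CARD('n)"
begin

lemma zero_mem: "0 \<in> L"
  using sublattice by (simp add: sublattice_def)

lemma diff_mem: "p \<in> L \<Longrightarrow> q \<in> L \<Longrightarrow> p - q \<in> L"
  using sublattice by (simp add: sublattice_def)

lemma uminus_mem: "p \<in> L \<Longrightarrow> - p \<in> L"
  using diff_mem[of 0 p] zero_mem by simp

lemma add_mem: "p \<in> L \<Longrightarrow> q \<in> L \<Longrightarrow> p + q \<in> L"
  using diff_mem[of p "- q"] uminus_mem by simp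

lemma sum_mem: "(\<And>i. i \<in> I \<Longrightarrow> f i \<in> L) \<Longrightarrow> sum f I \<in> L"
  by (induction I rule: infinite_finite_induct) (auto simp: zero_mem add_mem)

lemma int_multiple_mem:
  assumes "p \<in> L"
  shows "(\<chi> i. k * p $ i) \<in> L"
proof -
  have nat: "(\<chi> i. int m * p $ i) \<in> L" for m
  proof (induction m)
    case 0
    have "(\<chi> i. int 0 * p $ i) = 0" by (simp add: vec_eq_iff)
    then show ?case using zero_mem by simp
  next
    case (Suc m)
    have "(\<chi> i. int (Suc m) * p $ i) = (\<chi> i. int m * p $ i) + p"
      by (simp add: vec_eq_iff algebra_simps)
    then show ?case using Suc add_mem assms by simp
  qed
  show ?thesis
  proof (cases "0 \<le> k")
    case True
    then show ?thesis using nat[of "nat k"] by simp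
  next
    case False
    then have "(\<chi> i. k * p $ i) = - (\<chi> i. int (nat (- k)) * p $ i)"
      by (simp add: vec_eq_iff)
    then show ?thesis using nat uminus_mem by metis
  qed
qed

lemma deg_lattice: "p \<in> L \<Longrightarrow> deg R p = 0"
  using sublattice by (auto simp: sublattice_def mem_Lambda_R)

lemma deg_weights_pos: "0 < deg R (real_weights R)"
  by (rule deg_pos_component[of _ undefined]) (auto simp: less_eq_vec_def weights_pos)

lemma deg_strict_mono:
  fixes x y :: "'a::linordered_idom ^ 'n"
  assumes "x \<le> y" "x $ i < y $ i"
  shows "deg R x < deg R y"
  using deg_pos_component[of "y - x" i R] assms weights_pos
  by (simp add: deg_diff less_eq_vec_def)

text \<open>Since all weights are positive, the degree detects any strict increase of a coordinate.
  Comparisons between divisors of equal degree thus become equalities.\<close>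

lemma eq_if_le_deg_eq:
  fixes x y :: "'a::linordered_idom ^ 'n"
  assumes "x \<le> y" "deg R x = deg R y"
  shows "x = y"
proof (rule ccontr)
  assume "x \<noteq> y"
  then obtain i where "x $ i < y $ i"
    using assms(1) by (auto simp: vec_eq_iff less_eq_vec_def order_less_le)
  then show False using deg_strict_mono[OF assms(1)] assms(2) by force
qed

text \<open>The span lies in the hyperplane and has the same dimension, by the rank
  hypothesis.\<close>

lemma span_lattice: "span (real_vec ` L) = hyperplane_R R"
proof (rule subspace_dim_equal)
  show "subspace (hyperplane_R R)"
    unfolding hyperplane_R_eq_inner by (rule subspace_hyperplane)
  show "span (real_vec ` L) \<subseteq> hyperplane_R R"
    by (rule span_minimal[OF _ \<open>subspace (hyperplane_R R)\<close>])
      (auto simp: hyperplane_R_def deg_real_vec deg_lattice)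
  have "real_weights R \<noteq> 0"
    using deg_weights_pos by auto
  then show "dim (hyperplane_R R) \<le> dim (span (real_vec ` L))"
    using full_rank by (simp add: hyperplane_R_eq_inner dim_hyperplane lattice_rank_def)
qed simp

text \<open>Rounding down the coordinates with respect to a basis of the hyperplane that consists of
  lattice vectors moves a point by a bounded amount.\<close>

lemma lattice_point_near:
  obtains M where "0 < M" "\<And>x. x \<in> hyperplane_R R \<Longrightarrow> \<exists>q\<in>L. \<forall>i. real_vec q $ i \<le> x $ i + M"
proof -
  obtain B where B: "B \<subseteq> real_vec ` L" "independent B" "span B = hyperplane_R R"
    using maximal_independent_subset[of "real_vec ` L"] span_lattice
    by (metis span_mono span_span subset_antisym span_superset)
  have finB: "finite B" using B(2) by (rule independent_imp_finite)
  \<comment> \<open>The summand 1 keeps \<open>M\<close> positive even if the basis is empty, as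
    happens with a single coordinate.\<close>
  define M where "M = (\<Sum>b\<in>B. norm b) + 1"
  have "0 < M" unfolding M_def by (smt (verit) norm_ge_zero sum_nonneg)
  moreover have "\<exists>q\<in>L. \<forall>i. real_vec q $ i \<le> x $ i + M" if "x \<in> hyperplane_R R" for x
  proof -
    have "x \<in> range (\<lambda>c. \<Sum>b\<in>B. c b *\<^sub>R b)"
      using that B(3) span_finite[OF finB] by simp
    then obtain c where c: "x = (\<Sum>b\<in>B. c b *\<^sub>R b)"
      by blast
    define l where "l b = (SOME p. p \<in> L \<and> real_vec p = b)" for b
    have l: "l b \<in> L" "real_vec (l b) = b" if "b \<in> B" for b
    proof -
      have "\<exists>p. p \<in> L \<and> real_vec p = b" using that B(1) by auto
      from someI_ex[OF this] show "l b \<in> L" "real_vec (l b) = b" by (auto simp: l_def)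
    qed
    define q where "q = (\<Sum>b\<in>B. \<chi> i. \<lfloor>c b\<rfloor> * l b $ i)"
    have "q \<in> L" unfolding q_def by (intro sum_mem int_multiple_mem l)
    moreover have "real_vec q $ i \<le> x $ i + M" for i
    proof -
      have lb: "real_of_int (l b $ i) = b $ i" if "b \<in> B" for b
        using l(2)[OF that] by (metis real_vec_nth)
      have "real_vec q $ i - x $ i = (\<Sum>b\<in>B. (of_int \<lfloor>c b\<rfloor> - c b) * b $ i)"
        by (simp add: q_def c left_diff_distrib sum_subtractf lb)
      also have "\<dots> \<le> (\<Sum>b\<in>B. norm b)"
      proof (rule sum_mono)
        fix b assume "b \<in> B"
        have "\<bar>(of_int \<lfloor>c b\<rfloor> - c b) * b $ i\<bar> \<le> 1 * norm b"
          unfolding abs_mult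
          by (intro mult_mono component_le_norm_cart) (auto simp: abs_if, linarith+)
        then show "(of_int \<lfloor>c b\<rfloor> - c b) * b $ i \<le> norm b" by simp
      qed
      finally show ?thesis by (simp add: M_def)
    qed
    ultimately show ?thesis by blast
  qed
  ultimately show thesis using that by blast
qed

text \<open>A divisor of large degree dominates a lattice point. Its projection \<open>x\<close>
  along the weights has a lattice point at most \<open>M\<close> above it in each coordinate, and
  the multiple \<open>t\<close> of the weights taken away absorbs \<open>M\<close>, because every
  weight is at least 1.\<close>

lemma deg_Sigma_bounded:
  obtains C where "\<And>D. D \<in> Sigma_region L \<Longrightarrow> deg R D < C"
proof -
  obtain M where M: "0 < M"
    "\<And>x. x \<in> hyperplane_R R \<Longrightarrow> \<exists>q\<in>L. \<forall>i. real_vec q $ i \<le> x $ i + M"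
    using lattice_point_near by metis
  define W where "W = deg R (real_weights R)"
  have W: "0 < W" using deg_weights_pos by (simp add: W_def)
  have "deg R D < \<lceil>M * W\<rceil>" if S: "D \<in> Sigma_region L" for D
  proof (rule ccontr)
    assume "\<not> deg R D < \<lceil>M * W\<rceil>"
    then have large: "M * W \<le> of_int (deg R D)" by linarith
    define t where "t = of_int (deg R D) / W"
    have t: "M \<le> t" using large W by (simp add: t_def field_simps)
    define x where "x = real_vec D - t *\<^sub>R real_weights R"
    have "x \<in> hyperplane_R R"
      using W by (simp add: x_def hyperplane_R_def deg_diff deg_scaleR deg_real_vec t_def flip: W_def)
    then obtain q where q: "q \<in> L" "\<And>i. real_vec q $ i \<le> x $ i + M" using M(2) by blast
    have "q $ i \<le> D $ i" for i
    proof -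
      have "1 \<le> real (R $ i)" using weights_pos[of i] by linarith
      then have "M * 1 \<le> t * real (R $ i)" using t M(1) by (intro mult_mono) auto
      then have "real_of_int (q $ i) \<le> of_int (D $ i)" using q(2)[of i] by (simp add: x_def)
      then show ?thesis by simp
    qed
    then show False using S q(1) by (auto simp: Sigma_region_def less_eq_vec_def)
  qed
  then show thesis using that by blast
qed

section \<open>Extreme divisors as the maximal elements of the region\<close>

lemma extreme_iff:
  "\<nu> \<in> extreme_divisors R L \<longleftrightarrow> \<nu> \<in> Sigma_region L \<and> (\<forall>i. \<nu> + axis i 1 \<notin> Sigma_region L)"
proof safe
  assume ext: "\<nu> \<in> extreme_divisors R L"
  then show "\<nu> \<in> Sigma_region L" by (simp add: extreme_divisors_def)
  fix i assume S: "\<nu> + axis i 1 \<in> Sigma_region L"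
  have "(\<Sum>j\<in>UNIV. \<bar>(\<nu> + axis i 1) $ j - \<nu> $ j\<bar>) = (\<Sum>j\<in>UNIV. if j = i then 1 else 0)"
    by (rule sum.cong) (auto simp: axis_def)
  then have "\<nu> + axis i 1 \<in> neighbours \<nu>" by (simp add: neighbours_def)
  then have "deg R (\<nu> + axis i 1) \<le> deg R \<nu>"
    using ext S by (auto simp: extreme_divisors_def)
  then show False using weights_pos[of i] by (simp add: deg_add deg_axis)
next
  assume S: "\<nu> \<in> Sigma_region L" and notS: "\<forall>i. \<nu> + axis i 1 \<notin> Sigma_region L"
  have "deg R D \<le> deg R \<nu>" if D: "D \<in> neighbours \<nu>" "D \<in> Sigma_region L" for D
  proof (rule ccontr)
    assume "\<not> deg R D \<le> deg R \<nu>"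
    then have "\<not> D \<le> \<nu>" using deg_mono by blast
    then obtain i where i: "\<nu> $ i < D $ i" by (auto simp: less_eq_vec_def not_le)
    have "\<nu> + axis i 1 \<le> D"
      unfolding less_eq_vec_def
    proof
      fix j
      show "(\<nu> + axis i 1) $ j \<le> D $ j"
      proof (cases "j = i")
        case False
        \<comment> \<open>The increase in coordinate \<open>i\<close> already uses up the total
          deviation 1, so coordinate \<open>j\<close> cannot change.\<close>
        have "(\<Sum>k\<in>{i, j}. \<bar>D $ k - \<nu> $ k\<bar>) \<le> (\<Sum>k\<in>UNIV. \<bar>D $ k - \<nu> $ k\<bar>)"
          by (rule sum_mono2) auto
        then have "\<bar>D $ i - \<nu> $ i\<bar> + \<bar>D $ j - \<nu> $ j\<bar> \<le> 1"
          using D(1) False by (simp add: neighbours_def)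
        then show ?thesis using i False by (simp add: axis_def)
      qed (use i in simp)
    qed
    then show False using Sigma_region_downward[OF D(2)] notS by blast
  qed
  then show "\<nu> \<in> extreme_divisors R L" using S by (auto simp: extreme_divisors_def)
qed

lemma Sigma_below_extreme:
  assumes "D \<in> Sigma_region L"
  obtains \<nu> where "\<nu> \<in> extreme_divisors R L" "D \<le> \<nu>"
proof -
  obtain C where C: "\<And>D. D \<in> Sigma_region L \<Longrightarrow> deg R D < C" using deg_Sigma_bounded by blast
  \<comment> \<open>Minimising the gap to the degree bound \<open>C\<close> selects an element of
    maximal degree above \<open>D\<close>; raising any coordinate would narrow the gap.\<close>
  obtain \<nu> where \<nu>: "\<nu> \<in> Sigma_region L" "D \<le> \<nu>"
    and max: "\<And>E. E \<in> Sigma_region L \<Longrightarrow> D \<le> E \<Longrightarrow> nat (C - deg R \<nu>) \<le> nat (C - deg R E)"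
    using ex_has_least_nat[of "\<lambda>E. E \<in> Sigma_region L \<and> D \<le> E" D "\<lambda>E. nat (C - deg R E)"] assms
    by auto
  have "\<nu> + axis i 1 \<notin> Sigma_region L" for i
  proof
    assume S: "\<nu> + axis i 1 \<in> Sigma_region L"
    have "\<nu> \<le> \<nu> + axis i 1" by (simp add: less_eq_vec_def axis_def)
    then have "nat (C - deg R \<nu>) \<le> nat (C - deg R (\<nu> + axis i 1))"
      using max[OF S] \<nu>(2) order.trans by blast
    then show False
      using C[OF S] weights_pos[of i] by (simp add: deg_add deg_axis)
  qed
  then show thesis using that \<nu> extreme_iff by blast
qed

lemma extreme_nonempty: "extreme_divisors R L \<noteq> {}"
proof -
  have "- 1 \<in> Sigma_region L"
    unfolding Sigma_region_def
  proof safe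
    fix p assume "p \<in> L" and le: "p \<le> - 1"
    have neg: "p $ i < 0" for i
      using spec[OF le[unfolded less_eq_vec_def], of i] by simp
    have "deg R p < deg R (0 :: int ^ 'n)"
      by (rule deg_strict_mono[where i = undefined]) (auto simp: less_eq_vec_def neg less_imp_le)
    then show False using deg_lattice[OF \<open>p \<in> L\<close>] by simp
  qed
  then show ?thesis using Sigma_below_extreme by blast
qed

lemma extreme_witness:
  assumes "\<nu> \<in> extreme_divisors R L"
  obtains q where "q \<in> L" "q \<le> \<nu> + axis i 1"
  using assms unfolding extreme_iff Sigma_region_def by blast

text \<open>A lattice point below \<open>\<nu> + axis i 1\<close> has degree 0. The resulting bound
  guarantees that the minimum in \<open>g_min\<close> is attained.\<close>

lemma deg_extreme_bounded_below:
  assumes "\<nu> \<in> extreme_divisors R L"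
  shows "- int (R $ i) \<le> deg R \<nu>"
proof -
  obtain q where "q \<in> L" "q \<le> \<nu> + axis i 1" using extreme_witness[OF assms] .
  then have "deg R q \<le> deg R (\<nu> + axis i 1)" "deg R q = 0"
    by (auto intro: deg_mono deg_lattice)
  then show ?thesis by (simp add: deg_add deg_axis)
qed

lemma
  assumes "\<nu> \<in> extreme_divisors R L"
  shows g_min_le: "g_min R L \<le> deg R \<nu> + 1" and g_max_ge: "deg R \<nu> + 1 \<le> g_max R L"
proof -
  show "g_min R L \<le> deg R \<nu> + 1"
    unfolding g_min_def
    using Least_int_bounded_below(2)[of "deg R \<nu>" "deg R ` extreme_divisors R L"
        "- int (R $ undefined)" "deg R \<nu>"] assms deg_extreme_bounded_below by auto
  obtain C where C: "\<And>D. D \<in> Sigma_region L \<Longrightarrow> deg R D < C" using deg_Sigma_bounded by blast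
  then have "\<And>x. x \<in> deg R ` extreme_divisors R L \<Longrightarrow> x \<le> C"
    by (force simp: extreme_divisors_def)
  then show "deg R \<nu> + 1 \<le> g_max R L"
    unfolding g_max_def
    using Greatest_int_bounded_above(2)[of "deg R \<nu>" "deg R ` extreme_divisors R L" C "deg R \<nu>"]
      assms by auto
qed

lemma deg_extreme_const:
  assumes "\<And>\<nu>. \<nu> \<in> extreme_divisors R L \<Longrightarrow> deg R \<nu> = d"
  shows "g_min R L = d + 1" "g_max R L = d + 1"
proof -
  have "deg R ` extreme_divisors R L = {d}" using extreme_nonempty assms by auto
  then show "g_min R L = d + 1" "g_max R L = d + 1"
    unfolding g_min_def g_max_def by (auto intro: Least_equality Greatest_equality)
qed

lemma uniform_iff:
  "uniform_lattice R L \<longleftrightarrow> (\<forall>\<nu>\<in>extreme_divisors R L. deg R \<nu> = g_min R L - 1)"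
proof
  assume "uniform_lattice R L"
  then show "\<forall>\<nu>\<in>extreme_divisors R L. deg R \<nu> = g_min R L - 1"
    using g_min_le g_max_ge by (fastforce simp: uniform_lattice_def)
next
  assume "\<forall>\<nu>\<in>extreme_divisors R L. deg R \<nu> = g_min R L - 1"
  then show "uniform_lattice R L"
    using deg_extreme_const[of "g_min R L - 1"] by (simp add: uniform_lattice_def)
qed

text \<open>The two facts express that the \<open>LEAST\<close> in \<open>div_rank\<close> is an
  attained minimum: the degrees involved are nonnegative, and cutting \<open>D\<close> down below an
  extreme divisor provides a candidate.\<close>

lemma
  shows div_rank_le_deg: "0 \<le> E \<Longrightarrow> D - E \<in> Sigma_region L \<Longrightarrow> div_rank R L D \<le> deg R E - 1"
    and div_rank_witness: "\<exists>E\<ge>0. D - E \<in> Sigma_region L \<and> deg R E = div_rank R L D + 1"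
proof -
  define S where "S = {d. \<exists>E. effective E \<and> linear_system L (D - E) = {} \<and> d = deg R E}"
  have S: "S = {deg R E | E. 0 \<le> E \<and> D - E \<in> Sigma_region L}"
    by (auto simp: S_def effective_def linear_system_empty_iff uminus_mem)
  have rank: "div_rank R L D = (LEAST d. d \<in> S) - 1"
    by (simp add: div_rank_def S_def)
  have nonneg: "\<And>d. d \<in> S \<Longrightarrow> 0 \<le> d" by (auto simp: S deg_nonneg)
  obtain \<nu> where \<nu>: "\<nu> \<in> extreme_divisors R L" using extreme_nonempty by blast
  have "D - pos_part (D - \<nu>) \<le> \<nu>"
    using le_pos_part[of "D - \<nu>"] by (simp add: less_eq_vec_def algebra_simps)
  then have "D - pos_part (D - \<nu>) \<in> Sigma_region L"
    using \<nu> Sigma_region_downward extreme_iff by blast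
  then have "deg R (pos_part (D - \<nu>)) \<in> S"
    using pos_part_nonneg S by blast
  note least = Least_int_bounded_below[OF this nonneg]
  show "0 \<le> E \<Longrightarrow> D - E \<in> Sigma_region L \<Longrightarrow> div_rank R L D \<le> deg R E - 1"
    using least(2)[of "deg R E"] unfolding rank by (force simp: S)
  show "\<exists>E\<ge>0. D - E \<in> Sigma_region L \<and> deg R E = div_rank R L D + 1"
    using least(1) by (auto simp: rank S)
qed

lemma div_rank_le:
  assumes "\<nu> \<in> extreme_divisors R L"
  shows "div_rank R L D \<le> deg R (pos_part (D - \<nu>)) - 1"
proof (rule div_rank_le_deg[OF pos_part_nonneg])
  have "D - pos_part (D - \<nu>) \<le> \<nu>"
    using le_pos_part[of "D - \<nu>"] by (simp add: less_eq_vec_def algebra_simps)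
  then show "D - pos_part (D - \<nu>) \<in> Sigma_region L"
    using assms Sigma_region_downward by (auto simp: extreme_iff)
qed

text \<open>For an optimal \<open>E\<close>, the divisor \<open>D - E\<close> lies below some
  extreme \<open>\<nu>\<close>, so \<open>E\<close> dominates the positive part of
  \<open>D - \<nu>\<close>, which is therefore optimal as well.\<close>

lemma div_rank_attained:
  obtains \<nu> where "\<nu> \<in> extreme_divisors R L" "div_rank R L D = deg R (pos_part (D - \<nu>)) - 1"
proof -
  obtain E where E: "0 \<le> E" "D - E \<in> Sigma_region L" "deg R E = div_rank R L D + 1"
    using div_rank_witness by blast
  obtain \<nu> where \<nu>: "\<nu> \<in> extreme_divisors R L" "D - E \<le> \<nu>"
    using Sigma_below_extreme[OF E(2)] .
  have "D - \<nu> \<le> E" using \<nu>(2) by (simp add: less_eq_vec_def algebra_simps)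
  then have "deg R (pos_part (D - \<nu>)) \<le> deg R E"
    using E(1) by (intro deg_mono pos_part_least)
  then have "div_rank R L D = deg R (pos_part (D - \<nu>)) - 1"
    using div_rank_le[OF \<nu>(1), of D] E(3) by linarith
  then show thesis using that \<nu>(1) by blast
qed

lemma div_rank_ge: "- 1 \<le> div_rank R L D"
proof -
  obtain E where "0 \<le> E" "deg R E = div_rank R L D + 1"
    using div_rank_witness by blast
  then show ?thesis using deg_nonneg[of E R] by simp
qed

lemma div_rank_eq_minus_1_iff: "div_rank R L D = - 1 \<longleftrightarrow> D \<in> Sigma_region L"
proof
  assume rank: "div_rank R L D = - 1"
  obtain E where E: "0 \<le> E" "D - E \<in> Sigma_region L" "deg R E = div_rank R L D + 1"
    using div_rank_witness by blast
  have "E = 0" using eq_if_le_deg_eq[OF E(1)] E(3) rank by simp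
  then show "D \<in> Sigma_region L" using E(2) by simp
next
  assume "D \<in> Sigma_region L"
  then show "div_rank R L D = - 1"
    using div_rank_le_deg[of 0 D] div_rank_ge[of D] by simp
qed


section \<open>The Riemann-Roch formula in terms of extreme divisors\<close>

text \<open>If \<open>\<nu>\<close> computes the rank of \<open>D\<close>, then
  \<open>K - \<nu>\<close> is a competitor for the rank of \<open>K - D\<close>. This gives one
  inequality; replacing \<open>D\<close> by \<open>K - D\<close> gives the other.\<close>

lemma riemann_roch_if_symmetric:
  assumes deg: "\<And>\<nu>. \<nu> \<in> extreme_divisors R L \<Longrightarrow> deg R \<nu> = g - 1"
    and sym: "\<And>\<nu>. \<nu> \<in> extreme_divisors R L \<Longrightarrow> K - \<nu> \<in> extreme_divisors R L"
  shows "deg R K = 2 * g - 2"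
    and "div_rank R L D - div_rank R L (K - D) = deg R D - g + 1"
proof -
  obtain \<nu> where "\<nu> \<in> extreme_divisors R L" using extreme_nonempty by blast
  then show K: "deg R K = 2 * g - 2"
    using deg[of \<nu>] deg[OF sym[of \<nu>]] by (simp add: deg_diff)
  have le: "div_rank R L (K - D) \<le> div_rank R L D - deg R D + g - 1" for D
  proof -
    obtain \<nu> where \<nu>: "\<nu> \<in> extreme_divisors R L" "div_rank R L D = deg R (pos_part (D - \<nu>)) - 1"
      using div_rank_attained .
    have "div_rank R L (K - D) \<le> deg R (pos_part (K - D - (K - \<nu>))) - 1"
      using div_rank_le[OF sym[OF \<nu>(1)]] .
    also have "K - D - (K - \<nu>) = - (D - \<nu>)" by simp
    finally show ?thesis
      unfolding pos_part_uminus using \<nu> deg by (simp add: deg_diff)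
  qed
  show "div_rank R L D - div_rank R L (K - D) = deg R D - g + 1"
    using le[of D] le[of "K - D"] K by (simp add: deg_diff)
qed

lemma symmetric_if_riemann_roch:
  assumes K: "deg R K = 2 * m - 2"
    and RR: "\<And>D. div_rank R L D - div_rank R L (K - D) = deg R D - m + 1"
    and \<nu>: "\<nu> \<in> extreme_divisors R L"
  shows "deg R \<nu> = m - 1" and "K - \<nu> \<in> extreme_divisors R L"
proof -
  have deg_ext: "deg R \<nu> = m - 1" if \<nu>: "\<nu> \<in> extreme_divisors R L" for \<nu>
  proof (rule antisym)
    have "div_rank R L \<nu> = - 1" using \<nu> by (simp add: div_rank_eq_minus_1_iff extreme_iff)
    \<comment> \<open>The rank is never below -1, which bounds the degree of \<open>\<nu>\<close>
      from above.\<close>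
    then have rank: "div_rank R L (K - \<nu>) = m - 2 - deg R \<nu>" using RR[of \<nu>] by simp
    then show "deg R \<nu> \<le> m - 1" using div_rank_ge[of "K - \<nu>"] by simp
    show "m - 1 \<le> deg R \<nu>"
    proof (rule ccontr)
      assume "\<not> m - 1 \<le> deg R \<nu>"
      obtain E where E: "0 \<le> E" "K - \<nu> - E \<in> Sigma_region L" "deg R E = m - 1 - deg R \<nu>"
        using div_rank_witness[of "K - \<nu>"] rank by auto
      have "E \<noteq> 0" using E(3) \<open>\<not> m - 1 \<le> deg R \<nu>\<close> by auto
      then obtain i where i: "0 < E $ i"
        using E(1) by (auto simp: vec_eq_iff less_eq_vec_def order_less_le)
      \<comment> \<open>Moving one unit of coordinate \<open>i\<close> from the optimal
        \<open>E\<close> to \<open>\<nu>\<close> leaves the difference unchanged. The formula then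
        forces rank -1 at \<open>\<nu> + axis i 1\<close>, against the maximality of
        \<open>\<nu>\<close>.\<close>
      have "div_rank R L (K - (\<nu> + axis i 1)) \<le> deg R (E - axis i 1) - 1"
      proof (rule div_rank_le_deg)
        show "0 \<le> E - axis i 1"
          using E(1) i by (auto simp: less_eq_vec_def axis_def)
        show "K - (\<nu> + axis i 1) - (E - axis i 1) \<in> Sigma_region L"
          using E(2) by (simp add: algebra_simps)
      qed
      then have "div_rank R L (\<nu> + axis i 1) \<le> - 1"
        using RR[of "\<nu> + axis i 1"] E(3) by (simp add: deg_diff deg_add deg_axis)
      then have "\<nu> + axis i 1 \<in> Sigma_region L"
        using div_rank_ge[of "\<nu> + axis i 1"] by (simp flip: div_rank_eq_minus_1_iff)
      then show False using \<nu> by (simp add: extreme_iff)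
    qed
  qed
  show "deg R \<nu> = m - 1" by (rule deg_ext[OF \<nu>])
  have "div_rank R L (K - \<nu>) = - 1"
    using RR[of \<nu>] deg_ext[OF \<nu>] \<nu> div_rank_eq_minus_1_iff[of \<nu>] by (simp add: extreme_iff)
  then obtain \<mu> where \<mu>: "\<mu> \<in> extreme_divisors R L" "K - \<nu> \<le> \<mu>"
    using div_rank_eq_minus_1_iff Sigma_below_extreme by metis
  \<comment> \<open>Both degrees are \<open>m - 1\<close>, so the comparison with
    \<open>\<mu>\<close> is an equality.\<close>
  have "deg R (K - \<nu>) = deg R \<mu>"
    using deg_ext[OF \<nu>] deg_ext[OF \<mu>(1)] K by (simp add: deg_diff)
  then have "K - \<nu> = \<mu>" by (rule eq_if_le_deg_eq[OF \<mu>(2)])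
  then show "K - \<nu> \<in> extreme_divisors R L" using \<mu>(1) by simp
qed


section \<open>Critical points are the projections of extreme divisors\<close>

lemma mem_Delta_translate:
  assumes "p \<in> hyperplane_R R" "q \<in> L"
  shows "0 \<le> t \<and> (\<exists>x\<in>Delta_R R. real_vec q = p + t *\<^sub>R x)
    \<longleftrightarrow> real_vec q \<le> p + t *\<^sub>R real_weights R"
proof safe
  fix x assume "0 \<le> t" "x \<in> Delta_R R" "real_vec q = p + t *\<^sub>R x"
  then show "real_vec q \<le> p + t *\<^sub>R real_weights R"
    by (auto simp: Delta_R_def less_eq_vec_def mult_left_mono)
next
  assume le: "real_vec q \<le> p + t *\<^sub>R real_weights R"
  have deg: "deg R p = 0" "deg R (real_vec q) = 0"
    using assms by (auto simp: hyperplane_R_def deg_real_vec deg_lattice)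
  \<comment> \<open>Both \<open>p\<close> and \<open>q\<close> have degree 0, so the inequality by
    itself forces \<open>t\<close> to be nonnegative.\<close>
  have "0 \<le> t * deg R (real_weights R)"
    using deg_mono[OF le, of R] deg by (simp add: deg_add deg_scaleR)
  then show t: "0 \<le> t" using deg_weights_pos by (simp add: zero_le_mult_iff)
  show "\<exists>x\<in>Delta_R R. real_vec q = p + t *\<^sub>R x"
  \<comment> \<open>The point of the simplex is found by dividing by \<open>t\<close>; for
    \<open>t = 0\<close> equal degrees give \<open>q = p\<close> instead.\<close>
  proof (cases "t = 0")
    case True
    have "real_vec q = p" using eq_if_le_deg_eq[of "real_vec q" p] le True deg by simp
    moreover have "0 \<in> Delta_R R" by (simp add: Delta_R_def hyperplane_R_def less_eq_vec_def)
    ultimately show ?thesis using True by auto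
  next
    case False
    then have "(1 / t) *\<^sub>R (real_vec q - p) \<in> Delta_R R"
      using le t deg
      by (auto simp: Delta_R_def hyperplane_R_def deg_scaleR deg_diff less_eq_vec_def field_simps)
    then show ?thesis using False by (intro bexI) auto
  qed
qed

text \<open>Upper bounds on all coordinates also bound each coordinate from below, because the
  weighted sum of the coordinates is 0.\<close>

lemma finite_lattice_below: "finite {q \<in> L. real_vec q \<le> b}"
proof (rule finite_subset[OF _ finite_bounded_int_vec])
  define B where "B = (\<Sum>i\<in>UNIV. \<bar>\<lfloor>b $ i\<rfloor>\<bar> * int (R $ i))"
  show "{q \<in> L. real_vec q \<le> b} \<subseteq> {x. \<forall>i. x $ i \<in> {-B..B}}"
  proof clarify
    fix q i assume q: "q \<in> L" "real_vec q \<le> b"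
    have R1: "1 \<le> int (R $ j)" for j using weights_pos[of j] by simp
    have le: "q $ j \<le> \<bar>\<lfloor>b $ j\<rfloor>\<bar>" for j
      using q(2) by (force simp: less_eq_vec_def le_floor_iff intro: order.trans[OF _ abs_ge_self])
    have "\<bar>\<lfloor>b $ i\<rfloor>\<bar> * 1 \<le> \<bar>\<lfloor>b $ i\<rfloor>\<bar> * int (R $ i)" using R1 by (intro mult_left_mono) auto
    also have "\<dots> \<le> B" unfolding B_def by (rule member_le_sum) auto
    finally have upper: "q $ i \<le> B" using le[of i] by simp
    have "- (q $ i * int (R $ i)) = (\<Sum>j\<in>UNIV - {i}. q $ j * int (R $ j))"
      using deg_lattice[OF q(1)] unfolding deg_def by (simp add: sum.remove[of UNIV i])
    also have "\<dots> \<le> (\<Sum>j\<in>UNIV - {i}. \<bar>\<lfloor>b $ j\<rfloor>\<bar> * int (R $ j))"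
      using le by (intro sum_mono mult_right_mono) auto
    also have "\<dots> \<le> B" unfolding B_def by (intro sum_mono2) auto
    finally have "- (q $ i * int (R $ i)) \<le> B" .
    moreover have "- q $ i \<le> - (q $ i * int (R $ i))" if "q $ i \<le> 0"
      using mult_left_mono_neg[OF R1[of i] that] by simp
    moreover have "0 \<le> B" unfolding B_def by (intro sum_nonneg) auto
    ultimately have "- B \<le> q $ i" by linarith
    then show "q $ i \<in> {-B..B}" using upper by simp
  qed
qed

lemma real_vec_le_translate_iff:
  "real_vec q \<le> p + t *\<^sub>R real_weights R
    \<longleftrightarrow> Max (range (\<lambda>i. (of_int (q $ i) - p $ i) / real (R $ i))) \<le> t"
proof -
  have "of_int (q $ i) \<le> p $ i + t * real (R $ i) \<longleftrightarrow> (of_int (q $ i) - p $ i) / real (R $ i) \<le> t" for i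
    using weights_pos[of i] by (simp add: pos_divide_le_eq algebra_simps)
  then show ?thesis by (simp add: less_eq_vec_def)
qed

lemma
  assumes "p \<in> hyperplane_R R"
  shows dist_Delta_attained: "\<exists>q\<in>L. real_vec q \<le> p + dist_Delta R L p *\<^sub>R real_weights R"
    and dist_Delta_le: "\<And>q t. q \<in> L \<Longrightarrow> real_vec q \<le> p + t *\<^sub>R real_weights R \<Longrightarrow> dist_Delta R L p \<le> t"
proof -
  define f where "f q = Max (range (\<lambda>i. (of_int (q $ i) - p $ i) / real (R $ i)))" for q :: "int ^ 'n"
  have f: "real_vec q \<le> p + t *\<^sub>R real_weights R \<longleftrightarrow> f q \<le> t" for q t
    unfolding f_def by (rule real_vec_le_translate_iff)
  have dist: "dist_Delta R L p = (LEAST t. \<exists>q\<in>L. f q \<le> t)"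
  proof -
    have "(0 \<le> t \<and> (\<exists>q\<in>L. \<exists>x\<in>Delta_R R. real_vec q = p + t *\<^sub>R x)) = (\<exists>q\<in>L. f q \<le> t)" for t
      using mem_Delta_translate[OF assms] f by blast
    then show ?thesis by (simp add: dist_Delta_def)
  qed
  \<comment> \<open>Only lattice points no farther than the origin compete, and there are finitely
    many of them, so the minimum exists.\<close>
  define Q where "Q = {q \<in> L. f q \<le> f 0}"
  have "finite Q" unfolding Q_def using finite_lattice_below[of "p + f 0 *\<^sub>R real_weights R"] by (simp add: f)
  moreover have "Q \<noteq> {}" using zero_mem by (auto simp: Q_def)
  ultimately obtain q where q: "q \<in> Q" "\<And>q'. q' \<in> Q \<Longrightarrow> f q \<le> f q'"
    by (metis arg_min_if_finite(1) arg_min_least)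
  have least: "f q \<le> f q'" if "q' \<in> L" for q'
    using q that by (cases "f q' \<le> f 0") (auto simp: Q_def)
  have "dist_Delta R L p = f q"
    unfolding dist by (rule Least_equality) (use q(1) least in \<open>auto simp: Q_def intro: order.trans\<close>)
  then show "\<exists>q\<in>L. real_vec q \<le> p + dist_Delta R L p *\<^sub>R real_weights R"
    and "\<And>q t. q \<in> L \<Longrightarrow> real_vec q \<le> p + t *\<^sub>R real_weights R \<Longrightarrow> dist_Delta R L p \<le> t"
    using q(1) least f by (auto simp: Q_def intro: order.trans)
qed

text \<open>A lattice point strictly below the corner of the orthant would remain below it for a
  slightly smaller parameter.\<close>

lemma not_strictly_below_dist:
  assumes "p \<in> hyperplane_R R" "q \<in> L"
  shows "\<exists>i. (p + dist_Delta R L p *\<^sub>R real_weights R) $ i \<le> real_vec q $ i"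
proof (rule ccontr)
  assume "\<not> ?thesis"
  then have lt: "of_int (q $ i) < p $ i + dist_Delta R L p * real (R $ i)" for i
    by (simp add: not_le)
  have "(of_int (q $ i) - p $ i) / real (R $ i) < dist_Delta R L p" for i
    using lt[of i] weights_pos[of i] by (simp add: pos_divide_less_eq algebra_simps)
  then have "Max (range (\<lambda>i. (of_int (q $ i) - p $ i) / real (R $ i))) < dist_Delta R L p"
    by (subst Max_less_iff) auto
  moreover have "dist_Delta R L p \<le> Max (range (\<lambda>i. (of_int (q $ i) - p $ i) / real (R $ i)))"
    by (rule dist_Delta_le[OF assms]) (simp add: real_vec_le_translate_iff)
  ultimately show False by linarith
qed

text \<open>As the weights are normal to the hyperplane, this is the orthogonal projection onto
  it.\<close>

definition hyperplane_proj :: "real ^ 'n \<Rightarrow> real ^ 'n" where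
  "hyperplane_proj y = y - (deg R y / deg R (real_weights R)) *\<^sub>R real_weights R"

lemma hyperplane_proj_mem: "hyperplane_proj y \<in> hyperplane_R R"
  using deg_weights_pos by (simp add: hyperplane_proj_def hyperplane_R_def deg_diff deg_scaleR)

lemma hyperplane_proj_translate:
  assumes "x \<in> hyperplane_R R"
  shows "hyperplane_proj (x + t *\<^sub>R real_weights R) = x"
  using assms deg_weights_pos
  by (simp add: hyperplane_proj_def hyperplane_R_def deg_add deg_scaleR)

text \<open>At a local maximum \<open>x\<close> of the distance, a small move inside the hyperplane that raises
  coordinate \<open>i\<close> and lowers all others does not increase the distance. By discreteness this gives
  a lattice point touching the boundary of the translated orthant in coordinate \<open>i\<close> only.\<close>

lemma crit_witness:
  assumes x: "x \<in> crit R L" and y: "y = x + dist_Delta R L x *\<^sub>R real_weights R"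
  obtains q where "q \<in> L" "of_int (q $ i) = y $ i" "\<And>j. j \<noteq> i \<Longrightarrow> of_int (q $ j) < y $ j"
proof -
  obtain \<delta> where \<delta>: "0 < \<delta>" and xH: "x \<in> hyperplane_R R"
    and max: "\<And>p. p \<in> hyperplane_R R \<Longrightarrow> norm (p - x) \<le> \<delta> \<Longrightarrow> dist_Delta R L p \<le> dist_Delta R L x"
    using x by (auto simp: crit_def)
  define S where "S = (\<Sum>j\<in>UNIV. real (R $ j))"
  have "0 \<le> S" unfolding S_def by (intro sum_nonneg) auto
  \<comment> \<open>The total weight \<open>S\<close> is the factor for which this direction has
    degree 0.\<close>
  define w where "w = axis i S - real (R $ i) *\<^sub>R (1 :: real ^ 'n)"
  have deg_w: "deg R w = 0"
    by (simp add: w_def deg_diff deg_axis deg_scaleR) (simp add: deg_def S_def)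
  \<comment> \<open>This is the gap to the next integer strictly above \<open>y $ i\<close>: an
    integer below \<open>y $ i + a\<close> is at most \<open>y $ i\<close>.\<close>
  define a where "a = of_int \<lfloor>y $ i\<rfloor> + 1 - y $ i"
  have a: "0 < a" unfolding a_def by linarith
  define \<epsilon> where "\<epsilon> = min (\<delta> / (norm w + 1)) (a / (S + 1))"
  have \<epsilon>: "0 < \<epsilon>" using \<delta> a \<open>0 \<le> S\<close> by (simp add: \<epsilon>_def add_nonneg_pos)
  have "\<epsilon> * (norm w + 1) \<le> \<delta>"
    using norm_ge_zero[of w] by (simp add: \<epsilon>_def pos_le_divide_eq[symmetric] add_nonneg_pos)
  then have small: "norm (\<epsilon> *\<^sub>R w) \<le> \<delta>" using \<epsilon> by (simp add: algebra_simps)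
  have "\<epsilon> * (S + 1) \<le> a"
    using \<open>0 \<le> S\<close> by (simp add: \<epsilon>_def pos_le_divide_eq[symmetric] add_nonneg_pos)
  then have \<epsilon>S: "\<epsilon> * S < a" using \<epsilon> by (simp add: algebra_simps)
  have pH: "x + \<epsilon> *\<^sub>R w \<in> hyperplane_R R"
    using xH deg_w by (simp add: hyperplane_R_def deg_add deg_scaleR)
  have d: "dist_Delta R L (x + \<epsilon> *\<^sub>R w) \<le> dist_Delta R L x" using max[OF pH] small by simp
  obtain q where q: "q \<in> L"
    and le: "real_vec q \<le> x + \<epsilon> *\<^sub>R w + dist_Delta R L (x + \<epsilon> *\<^sub>R w) *\<^sub>R real_weights R"
    using dist_Delta_attained[OF pH] by blast
  have qy: "of_int (q $ j) \<le> y $ j + \<epsilon> * w $ j" for j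
  proof -
    have "of_int (q $ j) \<le> x $ j + \<epsilon> * w $ j + dist_Delta R L (x + \<epsilon> *\<^sub>R w) * real (R $ j)"
      using le by (simp add: less_eq_vec_def)
    also have "\<dots> \<le> x $ j + \<epsilon> * w $ j + dist_Delta R L x * real (R $ j)"
      using d by (simp add: mult_right_mono)
    finally show ?thesis by (simp add: y)
  qed
  have lt: "of_int (q $ j) < y $ j" if "j \<noteq> i" for j
  proof -
    have "0 < \<epsilon> * real (R $ i)" using \<epsilon> weights_pos[of i] by simp
    then show ?thesis using qy[of j] that by (simp add: w_def axis_def)
  qed
  have "0 \<le> \<epsilon> * real (R $ i)" using \<epsilon> by simp
  then have "of_int (q $ i) < y $ i + a"
    using qy[of i] \<epsilon>S by (simp add: w_def algebra_simps)
  then have "q $ i \<le> \<lfloor>y $ i\<rfloor>" unfolding a_def by linarith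
  then have qi: "of_int (q $ i) \<le> y $ i" by (simp add: le_floor_iff)
  obtain k where "y $ k \<le> of_int (q $ k)"
    using not_strictly_below_dist[OF xH q] y by auto
  then have "of_int (q $ i) = y $ i" using lt[of k] qi by (cases "k = i") auto
  then show thesis using that q lt by blast
qed

text \<open>The lattice points touching the orthant at a critical point make its corner
  \<open>y\<close> integral. Lying strictly below \<open>y\<close> then means lying below
  \<open>y - 1\<close>, which links the touching points to the witnesses of an extreme
  divisor.\<close>

lemma crit_eq: "crit R L = (\<lambda>\<nu>. hyperplane_proj (real_vec \<nu> + 1)) ` extreme_divisors R L"
proof (intro equalityI subsetI)
  fix x assume x: "x \<in> crit R L"
  then have xH: "x \<in> hyperplane_R R" by (simp add: crit_def)
  define y where "y = x + dist_Delta R L x *\<^sub>R real_weights R"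
  define \<nu> :: "int ^ 'n" where "\<nu> = (\<chi> i. \<lfloor>y $ i\<rfloor> - 1)"
  have y_int: "of_int \<lfloor>y $ i\<rfloor> = y $ i" for i
    using crit_witness[OF x y_def, of i] by (metis floor_of_int)
  then have y: "real_vec \<nu> + 1 = y" by (simp add: vec_eq_iff \<nu>_def)
  have y_nth: "of_int (\<nu> $ i) + 1 = y $ i" for i by (simp flip: y)
  have "\<nu> \<in> Sigma_region L"
    unfolding Sigma_region_def
  proof safe
    fix p assume p: "p \<in> L" "p \<le> \<nu>"
    obtain i where i: "y $ i \<le> of_int (p $ i)"
      using not_strictly_below_dist[OF xH p(1)] by (auto simp: y_def)
    have "p $ i \<le> \<nu> $ i" using p(2) by (simp add: less_eq_vec_def)
    then show False using i y_nth[of i] by linarith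
  qed
  moreover have "\<nu> + axis i 1 \<notin> Sigma_region L" for i
  proof -
    obtain q where q: "q \<in> L" "of_int (q $ i) = y $ i" "\<And>j. j \<noteq> i \<Longrightarrow> of_int (q $ j) < y $ j"
      using crit_witness[OF x y_def] by blast
    have "q $ j \<le> (\<nu> + axis i 1) $ j" for j
    proof (cases "j = i")
      case True
      then show ?thesis using q(2) y_nth[of i] by simp
    next
      case False
      then show ?thesis using q(3)[of j] y_nth[of j] by (simp add: axis_def)
    qed
    then show ?thesis using q(1) by (auto simp: Sigma_region_def less_eq_vec_def)
  qed
  ultimately have "\<nu> \<in> extreme_divisors R L" by (simp add: extreme_iff)
  moreover have "x = hyperplane_proj (real_vec \<nu> + 1)"
    unfolding y unfolding y_def by (rule hyperplane_proj_translate[OF xH, symmetric])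
  ultimately show "x \<in> (\<lambda>\<nu>. hyperplane_proj (real_vec \<nu> + 1)) ` extreme_divisors R L" by blast
next
  fix x assume "x \<in> (\<lambda>\<nu>. hyperplane_proj (real_vec \<nu> + 1)) ` extreme_divisors R L"
  then obtain \<nu> where \<nu>: "\<nu> \<in> extreme_divisors R L" and x: "x = hyperplane_proj (real_vec \<nu> + 1)"
    by blast
  have xH: "x \<in> hyperplane_R R" unfolding x by (rule hyperplane_proj_mem)
  define t where "t = deg R (real_vec \<nu> + 1) / deg R (real_weights R)"
  have y: "real_vec \<nu> + 1 = x + t *\<^sub>R real_weights R" by (simp add: x hyperplane_proj_def t_def)
  have y_nth: "of_int (\<nu> $ i) + 1 = x $ i + t * real (R $ i)" for i
    using arg_cong[OF y, of "\<lambda>v. v $ i"] by simp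
  \<comment> \<open>A smaller distance would put a lattice point strictly below
    \<open>real_vec \<nu> + 1\<close>, hence below \<open>\<nu>\<close>.\<close>
  have "t \<le> dist_Delta R L x"
  proof (rule ccontr)
    assume lt: "\<not> t \<le> dist_Delta R L x"
    obtain q where q: "q \<in> L" "real_vec q \<le> x + dist_Delta R L x *\<^sub>R real_weights R"
      using dist_Delta_attained[OF xH] by blast
    have "q $ i \<le> \<nu> $ i" for i
    proof -
      have "of_int (q $ i) \<le> x $ i + dist_Delta R L x * real (R $ i)"
        using q(2) by (simp add: less_eq_vec_def)
      also have "\<dots> < x $ i + t * real (R $ i)" using lt weights_pos[of i] by simp
      also have "\<dots> = of_int (\<nu> $ i) + 1" by (simp add: y_nth)
      finally show ?thesis by linarith
    qed
    then show False using q(1) \<nu> by (auto simp: extreme_iff Sigma_region_def less_eq_vec_def)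
  qed
  moreover have "dist_Delta R L p \<le> t" if p: "p \<in> hyperplane_R R" "norm (p - x) \<le> 1" for p
  proof -
    \<comment> \<open>Two points of degree 0 cannot differ by a decrease in every coordinate. The
      witness for a coordinate \<open>i\<close> that does not decrease has slack 1 in all others, so
      the radius 1 suffices.\<close>
    have "\<exists>i. 0 \<le> (p - x) $ i"
    proof (rule ccontr)
      assume "\<not> ?thesis"
      then have neg: "p $ i < x $ i" for i by (simp add: not_le)
      then have "deg R p < deg R x"
        by (intro deg_strict_mono[of _ _ undefined]) (auto simp: less_eq_vec_def less_imp_le)
      then show False using p(1) xH by (simp add: hyperplane_R_def)
    qed
    then obtain i where i: "x $ i \<le> p $ i" by auto
    obtain q where q: "q \<in> L" "q \<le> \<nu> + axis i 1" using extreme_witness[OF \<nu>] .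
    have "of_int (q $ j) \<le> p $ j + t * real (R $ j)" for j
    proof (cases "j = i")
      case True
      have "q $ i \<le> \<nu> $ i + 1" using q(2) by (auto simp: less_eq_vec_def axis_def split: if_splits)
      then have "of_int (q $ i) \<le> of_int (\<nu> $ i) + (1 :: real)" by linarith
      then show ?thesis unfolding True using i y_nth[of i] by linarith
    next
      case False
      have "q $ j \<le> \<nu> $ j" using spec[OF q(2)[unfolded less_eq_vec_def], of j] False by (simp add: axis_def)
      moreover have "\<bar>p $ j - x $ j\<bar> \<le> 1"
        using component_le_norm_cart[of "p - x" j] p(2) by simp
      ultimately show ?thesis using y_nth[of j] by linarith
    qed
    then show ?thesis
      by (intro dist_Delta_le[OF p(1) q(1)]) (simp add: less_eq_vec_def)
  qed
  ultimately show "x \<in> crit R L"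
    unfolding crit_def using xH by (auto intro!: exI[of _ 1] intro: order.trans)
qed


section \<open>Reflection invariance of uniform lattices\<close>

lemma reflection_invariant_iff:
  assumes deg: "\<And>\<nu>. \<nu> \<in> extreme_divisors R L \<Longrightarrow> deg R \<nu> = d"
  shows "reflection_invariant R L
    \<longleftrightarrow> (\<exists>K. \<forall>\<nu>\<in>extreme_divisors R L. K - \<nu> \<in> extreme_divisors R L)"
proof -
  \<comment> \<open>With constant degree \<open>d\<close>, the projection subtracts the same
    multiple of the weights from every \<open>real_vec \<nu> + 1\<close>, so it is the translation
    by \<open>- s\<close>.\<close>
  define s where "s = ((of_int d + deg R (1 :: real ^ 'n)) / deg R (real_weights R)) *\<^sub>R real_weights R - 1"
  have crit: "crit R L = (\<lambda>\<nu>. real_vec \<nu> - s) ` extreme_divisors R L"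
    unfolding crit_eq
    by (rule image_cong) (auto simp: hyperplane_proj_def deg_add deg_real_vec deg s_def)
  show ?thesis
  proof
    assume "reflection_invariant R L"
    then obtain v where v: "uminus ` crit R L = (\<lambda>x. x + v) ` crit R L"
      by (auto simp: reflection_invariant_def)
    have reflect: "\<exists>\<mu>\<in>extreme_divisors R L. real_vec \<nu> + real_vec \<mu> = 2 *\<^sub>R s - v"
      if "\<nu> \<in> extreme_divisors R L" for \<nu>
    proof -
      have "- (real_vec \<nu> - s) \<in> (\<lambda>x. x + v) ` crit R L"
        unfolding v[symmetric] unfolding crit using that by (intro imageI)
      then obtain \<mu> where "\<mu> \<in> extreme_divisors R L" "- (real_vec \<nu> - s) = real_vec \<mu> - s + v"
        by (auto simp: crit)
      moreover from this(2) have "real_vec \<nu> + real_vec \<mu> = 2 *\<^sub>R s - v"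
        by (simp add: vec_eq_iff algebra_simps)
      ultimately show ?thesis by blast
    qed
    obtain \<nu>0 where \<nu>0: "\<nu>0 \<in> extreme_divisors R L" using extreme_nonempty by blast
    obtain \<mu>0 where \<mu>0: "real_vec \<nu>0 + real_vec \<mu>0 = 2 *\<^sub>R s - v" using reflect[OF \<nu>0] by blast
    \<comment> \<open>The vector \<open>v\<close> is only real; writing
      \<open>2 *\<^sub>R s - v\<close> as a sum of two divisors shows that the centre of the
      symmetry comes from an integral \<open>K\<close>.\<close>
    have "\<nu>0 + \<mu>0 - \<nu> \<in> extreme_divisors R L" if \<nu>: "\<nu> \<in> extreme_divisors R L" for \<nu>
    proof -
      obtain \<mu> where \<mu>: "\<mu> \<in> extreme_divisors R L" "real_vec \<nu> + real_vec \<mu> = 2 *\<^sub>R s - v"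
        using reflect[OF \<nu>] by blast
      then have "real_vec \<nu> + real_vec \<mu> = real_vec \<nu>0 + real_vec \<mu>0" using \<mu>0 by simp
      then have "\<mu> = \<nu>0 + \<mu>0 - \<nu>"
        by (simp add: vec_eq_iff algebra_simps flip: of_int_add)
      then show ?thesis using \<mu>(1) by simp
    qed
    then show "\<exists>K. \<forall>\<nu>\<in>extreme_divisors R L. K - \<nu> \<in> extreme_divisors R L" by blast
  next
    assume "\<exists>K. \<forall>\<nu>\<in>extreme_divisors R L. K - \<nu> \<in> extreme_divisors R L"
    then obtain K where K: "\<And>\<nu>. \<nu> \<in> extreme_divisors R L \<Longrightarrow> K - \<nu> \<in> extreme_divisors R L" by blast
    define v where "v = 2 *\<^sub>R s - real_vec K"
    have eq: "- (real_vec \<nu> - s) = real_vec (K - \<nu>) - s + v" for \<nu>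
      by (simp add: v_def real_vec_diff scaleR_2)
    \<comment> \<open>The map is an involution, so mapping the set into itself suffices.\<close>
    have "(\<lambda>\<nu>. K - \<nu>) ` extreme_divisors R L = extreme_divisors R L"
      using K by (auto simp: image_iff intro!: bexI[of _ "K - _"])
    then have "(\<lambda>x. x + v) ` crit R L
        = (\<lambda>x. x + v) ` (\<lambda>\<nu>. real_vec \<nu> - s) ` (\<lambda>\<nu>. K - \<nu>) ` extreme_divisors R L"
      by (simp add: crit)
    also have "\<dots> = uminus ` crit R L"
      unfolding crit image_image eq ..
    finally show "reflection_invariant R L" unfolding reflection_invariant_def by metis
  qed
qed

lemma riemann_roch_iff:
  "riemann_roch_formula R L \<longleftrightarrow> uniform_lattice R L \<and> reflection_invariant R L"
  and riemann_roch_property_if_formula: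
  "riemann_roch_formula R L \<Longrightarrow> riemann_roch_property R L"
proof -
  have fwd: "uniform_lattice R L \<and> reflection_invariant R L" if RR: "riemann_roch_formula R L"
  proof -
    obtain m K where mK: "deg R K = 2 * m - 2"
      "\<And>D. div_rank R L D - div_rank R L (K - D) = deg R D - m + 1"
      using RR by (auto simp: riemann_roch_formula_def)
    note sym = symmetric_if_riemann_roch[OF mK]
    have "uniform_lattice R L"
      using deg_extreme_const[OF sym(1)] by (simp add: uniform_lattice_def)
    then show ?thesis using reflection_invariant_iff[OF sym(1)] sym(2) by blast
  qed
  \<comment> \<open>The property contains the formula with \<open>m = g_min R L\<close>, so this one
    implication serves both claims.\<close>
  have bwd: "riemann_roch_property R L" if uniform: "uniform_lattice R L" and reflection: "reflection_invariant R L"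
  proof -
    have deg: "\<And>\<nu>. \<nu> \<in> extreme_divisors R L \<Longrightarrow> deg R \<nu> = g_min R L - 1"
      using uniform uniform_iff by blast
    then obtain K where "\<And>\<nu>. \<nu> \<in> extreme_divisors R L \<Longrightarrow> K - \<nu> \<in> extreme_divisors R L"
      using reflection_invariant_iff reflection by blast
    from riemann_roch_if_symmetric[OF deg this] show ?thesis
      unfolding riemann_roch_property_def using uniform by blast
  qed
  show "riemann_roch_formula R L \<longleftrightarrow> uniform_lattice R L \<and> reflection_invariant R L"
    using fwd bwd unfolding riemann_roch_formula_def riemann_roch_property_def by blast
  show "riemann_roch_formula R L \<Longrightarrow> riemann_roch_property R L"
    using fwd bwd by blast
qed

end

theorem theorem2p26:
  fixes R :: "nat ^ 'n" and L :: "(int ^ 'n) set" and n :: nat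
  assumes "CARD('n) = n + 1"
    and "\<forall>i. 0 < R $ i"
    and "sublattice L (Lambda_R R)"
    and "lattice_rank L = n"
  shows "(riemann_roch_formula R L \<longleftrightarrow> uniform_lattice R L \<and> reflection_invariant R L)
    \<and> (riemann_roch_formula R L \<longrightarrow> riemann_roch_property R L)"
proof -
  interpret full_rank_lattice R L
    using assms by unfold_locales auto
  show ?thesis
    using riemann_roch_iff riemann_roch_property_if_formula by blast
qed

end
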